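(* Let $A\in\mathbb{R}^{m\times n}$ and $L\in\mathbb{R}^{p\times n}$ with $\mathrm{rank}((A^{\top},L^{\top})^{\top})=r$, and let $A=P_AC_AX^{-1}$, $L=P_LS_LX^{-1}$ be a GSVD of $\{A,L\}$ (in the form given in the context), with $X=(x_1,\dots,x_n)$. Let $M=A^{\top}A+L^{\top}L$ and partition $X=(X_1\ \ X_2)$, where $X_1\in\mathbb{R}^{n\times r}$ consists of the first $r$ columns and $X_2\in\mathbb{R}^{n\times(n-r)}$ of the last $n-r$ columns. Then $\mathcal{R}(X_2)=\mathcal{N}(M)$. Moreover, let $$\bar X=(\bar X_1\ \ X_2),\qquad \bar X_1=(\mathcal{P}_{\mathcal{R}(M)}x_1,\dots,\mathcal{P}_{\mathcal{R}(M)}x_r).$$ Then ($\bar X$ is invertible and) $$A=P_AC_A\bar X^{-1},\qquad L=P_LS_L\bar X^{-1}.$$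
   Context: $\mathcal{R}(\cdot)$ and $\mathcal{N}(\cdot)$ denote the range (column space) and null space of a matrix; $\mathcal{P}_{\mathcal{R}(M)}$ is the Euclidean orthogonal projection of $\mathbb{R}^n$ onto $\mathcal{R}(M)$. GSVD: for $A\in\mathbb{R}^{m\times n}$, $L\in\mathbb{R}^{p\times n}$ with $\mathrm{rank}((A^{\top},L^{\top})^{\top})=r$, a GSVD of $\{A,L\}$ is a pair of factorizations $A=P_AC_AX^{-1}$, $L=P_LS_LX^{-1}$ with $P_A\in\mathbb{R}^{m\times m}$, $P_L\in\mathbb{R}^{p\times p}$ orthogonal, $X\in\mathbb{R}^{n\times n}$ invertible, $C_A=(\Sigma_A\ \ \mathbf{0})\in\mathbb{R}^{m\times n}$, $S_L=(\Sigma_L\ \ \mathbf{0})\in\mathbb{R}^{p\times n}$ (the zero blocks having $n-r$ columns), where $\Sigma_A\in\mathbb{R}^{m\times r}$ and $\Sigma_L\in\mathbb{R}^{p\times r}$ are block diagonal with (possibly rectangular or empty) diagonal blocks $$\Sigma_A:\ I_{q_1},\ C_{q_2},\ \mathbf{0}_{(m-q_1-q_2)\times q_3};\qquad \Sigma_L:\ \mathbf{0}_{(p-r+q_1)\times q_1},\ S_{q_2},\ I_{q_3},$$ with $q_1+q_2+q_3=r$, $C_{q_2}=\mathrm{diag}(c_{q_1+1},\dots,c_{q_1+q_2})$, $1>c_{q_1+1}\ge\cdots\ge c_{q_1+q_2}>0$, $S_{q_2}=\mathrm{diag}(s_{q_1+1},\dots,s_{q_1+q_2})$, $0<s_{q_1+1}\le\cdots\le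 s_{q_1+q_2}<1$, and $\Sigma_A^{\top}\Sigma_A+\Sigma_L^{\top}\Sigma_L=I_r$. *)

theory Defs
  imports
    "Jordan_Normal_Form.DL_Rank"
    "Jordan_Normal_Form.Matrix_Kernel"
    "Jordan_Normal_Form.Gauss_Jordan_Elimination"
begin

text \<open>Horizontal juxtaposition \<open>(A  B)\<close>, the counterpart of the library's \<open>A @\<^sub>r B\<close>.\<close>

definition append_cols :: "real mat \<Rightarrow> real mat \<Rightarrow> real mat" where
  "append_cols A B = four_block_mat A B (0\<^sub>m 0 (dim_col A)) (0\<^sub>m 0 (dim_col B))"

text \<open>The inverse of an invertible matrix; unspecified if the matrix is singular, so it is
  always used together with \<open>invertible_mat\<close>.\<close>

definition mat_inv :: "real mat \<Rightarrow> real mat" where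
  "mat_inv X = the (mat_inverse X)"

text \<open>The library's \<open>orthogonal_mat\<close> only asks for pairwise orthogonal nonzero columns, not for
  orthonormal ones.\<close>

definition orthonormal_mat :: "nat \<Rightarrow> real mat \<Rightarrow> bool" where
  "orthonormal_mat k P \<longleftrightarrow> P \<in> carrier_mat k k \<and> P\<^sup>T * P = 1\<^sub>m k \<and> P * P\<^sup>T = 1\<^sub>m k"

text \<open>Euclidean orthogonal projection of \<open>\<real>\<^sup>n\<close> onto the subspace \<open>W\<close>.\<close>

definition orth_proj :: "nat \<Rightarrow> real vec set \<Rightarrow> real vec \<Rightarrow> real vec" where
  "orth_proj n W x = (THE y. y \<in> W \<and> x - y \<in> vec_module.orthogonal_complement n W)"

text \<open>The block diagonal factors. The entries \<open>c\<close> and \<open>s\<close> are indexed by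
  \<open>q1 + 1, \<dots>, q1 + q2\<close>, and blocks may have zero rows or zero columns. The number of rows
  \<open>p - r + q1\<close> of the zero block of \<open>gsvd_Sigma_L\<close> is written \<open>p + q1 - r\<close>, because
  subtraction of natural numbers truncates and \<open>p < r\<close> is possible.\<close>

definition gsvd_Sigma_A :: "nat \<Rightarrow> nat \<Rightarrow> nat \<Rightarrow> nat \<Rightarrow> (nat \<Rightarrow> real) \<Rightarrow> real mat" where
  "gsvd_Sigma_A m q1 q2 q3 c =
     diag_block_mat [1\<^sub>m q1, mat_diag q2 (\<lambda>i. c (q1 + 1 + i)), 0\<^sub>m (m - q1 - q2) q3]"

definition gsvd_Sigma_L :: "nat \<Rightarrow> nat \<Rightarrow> nat \<Rightarrow> nat \<Rightarrow> nat \<Rightarrow> (nat \<Rightarrow> real) \<Rightarrow> real mat" where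
  "gsvd_Sigma_L p r q1 q2 q3 s =
     diag_block_mat [0\<^sub>m (p + q1 - r) q1, mat_diag q2 (\<lambda>i. s (q1 + 1 + i)), 1\<^sub>m q3]"

definition gsvd_factors ::
  "nat \<Rightarrow> nat \<Rightarrow> nat \<Rightarrow> nat \<Rightarrow> real mat \<Rightarrow> real mat \<Rightarrow> bool" where
  "gsvd_factors m p n r C_A S_L \<longleftrightarrow>
     (\<exists>q1 q2 q3 c s.
        q1 + q2 + q3 = r \<and> q1 + q2 \<le> m \<and> r \<le> p + q1 \<and>
        (\<forall>i\<in>{q1 + 1..q1 + q2}. 0 < c i \<and> c i < 1) \<and>
        (\<forall>i\<in>{q1 + 1..q1 + q2}. \<forall>j\<in>{q1 + 1..q1 + q2}. i \<le> j \<longrightarrow> c j \<le> c i) \<and>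
        (\<forall>i\<in>{q1 + 1..q1 + q2}. 0 < s i \<and> s i < 1) \<and>
        (\<forall>i\<in>{q1 + 1..q1 + q2}. \<forall>j\<in>{q1 + 1..q1 + q2}. i \<le> j \<longrightarrow> s i \<le> s j) \<and>
        (let \<Sigma>A = gsvd_Sigma_A m q1 q2 q3 c; \<Sigma>L = gsvd_Sigma_L p r q1 q2 q3 s in
           \<Sigma>A\<^sup>T * \<Sigma>A + \<Sigma>L\<^sup>T * \<Sigma>L = 1\<^sub>m r \<and>
           C_A = append_cols \<Sigma>A (0\<^sub>m m (n - r)) \<and>
           S_L = append_cols \<Sigma>L (0\<^sub>m p (n - r))))"

text \<open>\<open>r\<close> is meant to be the rank of the \<open>(m + p) \<times> n\<close> matrix \<open>A @\<^sub>r L\<close>; this is not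
  part of the definition and has to be assumed separately.\<close>

definition is_gsvd ::
  "nat \<Rightarrow> nat \<Rightarrow> nat \<Rightarrow> nat \<Rightarrow> real mat \<Rightarrow> real mat \<Rightarrow>
   real mat \<Rightarrow> real mat \<Rightarrow> real mat \<Rightarrow> real mat \<Rightarrow> real mat \<Rightarrow> bool" where
  "is_gsvd m p n r A L P_A C_A P_L S_L X \<longleftrightarrow>
     orthonormal_mat m P_A \<and> orthonormal_mat p P_L \<and>
     X \<in> carrier_mat n n \<and> invertible_mat X \<and>
     gsvd_factors m p n r C_A S_L \<and>
     A = P_A * C_A * mat_inv X \<and>
     L = P_L * S_L * mat_inv X"

end

theory Submission
  imports Defs
begin

text \<open>Put \<open>V = X\<inverse>\<close>. Orthogonality of \<open>P_A\<close> and \<open>P_L\<close> gives \<open>M = V\<^sup>T D V\<close> with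
  \<open>D = diag(I\<^sub>r, 0)\<close>, so \<open>\<N>(M) = \<R>(X\<^sub>2)\<close>. If \<open>X\<^sub>2\<^sup>T y = 0\<close>, then \<open>D X\<^sup>T y = X\<^sup>T y\<close>, so
  \<open>y = M (X X\<^sup>T y)\<close> lies in \<open>\<R>(M)\<close>. Hence the projection onto \<open>\<R>(M)\<close> subtracts the component
  in \<open>\<R>(X\<^sub>2)\<close>, and the projected columns form \<open>X\<^sub>1 + X\<^sub>2 K\<close> with
  \<open>K = - (X\<^sub>2\<^sup>T X\<^sub>2)\<inverse> X\<^sub>2\<^sup>T X\<^sub>1\<close>. The new matrix is thus \<open>X T\<close> with \<open>T\<close> unit lower
  triangular with lower left block \<open>K\<close>, and \<open>C_A T = C_A\<close>, \<open>S_L T = S_L\<close> because the last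
  \<open>n - r\<close> columns of \<open>C_A\<close> and \<open>S_L\<close> vanish.\<close>

section \<open>Inverses and elementary matrix identities\<close>

lemma mat_inv_inverse:
  assumes X: "X \<in> carrier_mat n n" and inv: "invertible_mat X"
  shows "X * mat_inv X = 1\<^sub>m n" "mat_inv X * X = 1\<^sub>m n" "mat_inv X \<in> carrier_mat n n"
proof -
  obtain B where B: "X * B = 1\<^sub>m n" "B * X = 1\<^sub>m (dim_row B)"
    using inv X unfolding invertible_mat_def inverts_mat_def by auto
  \<comment> \<open>The definition of \<open>invertible_mat\<close> leaves the format of
    \<open>B\<close> open; the two product identities determine it.\<close>
  have "dim_col B = n" "dim_row B = n"
    using arg_cong[OF B(1), of dim_col] arg_cong[OF B(2), of dim_col] X by auto
  \<comment> \<open>Membership in the units of the matrix ring rules out the result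
    \<open>None\<close> of \<open>mat_inverse\<close>, so \<open>the\<close> in
    \<open>mat_inv\<close> meets a proper value.\<close>
  with B X have "X \<in> Units (ring_mat TYPE(real) n ())"
    unfolding Units_def ring_mat_def by auto
  then obtain C where C: "mat_inverse X = Some C"
    using mat_inverse(1)[OF X, where b = "()"] by fastforce
  then show "X * mat_inv X = 1\<^sub>m n" "mat_inv X * X = 1\<^sub>m n" "mat_inv X \<in> carrier_mat n n"
    using mat_inverse(2)[OF X C] by (auto simp: mat_inv_def)
qed

lemma invertible_matI:
  assumes "A \<in> carrier_mat n n" "B \<in> carrier_mat n n" "A * B = 1\<^sub>m n" "B * A = 1\<^sub>m n"
  shows "invertible_mat A"
  using assms unfolding invertible_mat_def inverts_mat_def by auto

lemma mult_mat_zero_vec: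
  fixes A :: "real mat"
  assumes "A \<in> carrier_mat nr nc"
  shows "A *\<^sub>v 0\<^sub>v nc = 0\<^sub>v nr"
  using assms by (intro eq_vecI) auto

lemma uminus_r_inv_mat:
  fixes A :: "'a :: group_add mat"
  assumes "A \<in> carrier_mat nr nc"
  shows "A + - A = 0\<^sub>m nr nc"
  using assms by (intro eq_matI) auto

section \<open>Juxtaposed blocks and unit lower triangular factors\<close>

lemma append_cols_carrier:
  assumes "A \<in> carrier_mat nr a" "B \<in> carrier_mat nr b"
  shows "append_cols A B \<in> carrier_mat nr (a + b)"
  using assms unfolding append_cols_def by auto

lemma append_cols_mult_vec:
  assumes A: "A \<in> carrier_mat nr a" and B: "B \<in> carrier_mat nr b"
    and x: "x \<in> carrier_vec a" and y: "y \<in> carrier_vec b"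
  shows "append_cols A B *\<^sub>v (x @\<^sub>v y) = A *\<^sub>v x + B *\<^sub>v y"
proof -
  have "append_cols A B *\<^sub>v (x @\<^sub>v y)
      = (A *\<^sub>v x + B *\<^sub>v y) @\<^sub>v (0\<^sub>m 0 a *\<^sub>v x + 0\<^sub>m 0 b *\<^sub>v y)"
    unfolding append_cols_def
    using A B four_block_mat_mult_vec[OF A B _ _ x y, of "0\<^sub>m 0 a" 0 "0\<^sub>m 0 b"] by simp
  \<comment> \<open>The lower blocks have no rows, so the appended vector is empty.\<close>
  also have "\<dots> = A *\<^sub>v x + B *\<^sub>v y"
    using A B by (intro eq_vecI) auto
  finally show ?thesis .
qed

lemma transpose_append_cols_mult_vec:
  assumes A: "A \<in> carrier_mat nr a" and B: "B \<in> carrier_mat nr b"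
    and y: "y \<in> carrier_vec nr"
  shows "(append_cols A B)\<^sup>T *\<^sub>v y = (A\<^sup>T *\<^sub>v y) @\<^sub>v (B\<^sup>T *\<^sub>v y)"
proof (rule eq_vecI)
  fix i assume i: "i < dim_vec ((A\<^sup>T *\<^sub>v y) @\<^sub>v (B\<^sup>T *\<^sub>v y))"
  have "col (append_cols A B) i = (if i < a then col A i else col B (i - a))"
    using i A B by (intro eq_vecI) (auto simp: append_cols_def)
  then show "((append_cols A B)\<^sup>T *\<^sub>v y) $ i = ((A\<^sup>T *\<^sub>v y) @\<^sub>v (B\<^sup>T *\<^sub>v y)) $ i"
    using i A B by (auto simp: append_cols_def)
qed (use A B in \<open>auto simp: append_cols_def\<close>)

lemma append_cols_cols:
  assumes X: "X \<in> carrier_mat n k" and r: "r \<le> k"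
  shows "append_cols (mat_of_cols n (take r (cols X))) (mat_of_cols n (drop r (cols X))) = X"
  using assms by (intro eq_matI) (auto simp: append_cols_def mat_of_cols_index)

text \<open>Each zero column gives a zero row and a zero column of the Gram matrix. Applied to both
  factors of the GSVD, this produces the zero blocks of \<open>D\<close>.\<close>

lemma gram_append_zero_cols:
  assumes A: "A \<in> carrier_mat nr a"
  shows "(append_cols A (0\<^sub>m nr b))\<^sup>T * append_cols A (0\<^sub>m nr b)
    = four_block_mat (A\<^sup>T * A) (0\<^sub>m a b) (0\<^sub>m b a) (0\<^sub>m b b)"
proof -
  have "(append_cols A (0\<^sub>m nr b))\<^sup>T = four_block_mat A\<^sup>T (0\<^sub>m a 0) (0\<^sub>m b nr) (0\<^sub>m b 0)"
    unfolding append_cols_def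
    using A transpose_four_block_mat[of A nr a "0\<^sub>m nr b" b "0\<^sub>m 0 a" 0 "0\<^sub>m 0 b"] by simp
  then show ?thesis
    unfolding append_cols_def
    using A mult_four_block_mat[of "A\<^sup>T" a nr "0\<^sub>m a 0" 0 "0\<^sub>m b nr" b "0\<^sub>m b 0" A a "0\<^sub>m nr b" b "0\<^sub>m 0 a" "0\<^sub>m 0 b"]
    by simp
qed

text \<open>A column operation in matrix form: as a right factor it adds to the first
  \<open>a\<close> columns the combinations of the last \<open>b\<close> columns prescribed by
  \<open>K\<close>.\<close>

definition unit_lower :: "nat \<Rightarrow> nat \<Rightarrow> real mat \<Rightarrow> real mat" where
  "unit_lower a b K = four_block_mat (1\<^sub>m a) (0\<^sub>m a b) K (1\<^sub>m b)"

lemma unit_lower_carrier: "unit_lower a b K \<in> carrier_mat (a + b) (a + b)"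
  unfolding unit_lower_def by auto

text \<open>With identities on the diagonal, the lower left blocks simply add. Taking
  \<open>J = - K\<close> supplies the inverse of the correction factor.\<close>

lemma unit_lower_mult:
  assumes "K \<in> carrier_mat b a" "J \<in> carrier_mat b a"
  shows "unit_lower a b K * unit_lower a b J = unit_lower a b (K + J)"
  unfolding unit_lower_def
  using assms mult_four_block_mat[of "1\<^sub>m a" a a "0\<^sub>m a b" b K b "1\<^sub>m b" "1\<^sub>m a" a "0\<^sub>m a b" b J "1\<^sub>m b"]
  by simp

text \<open>Serves two purposes: with \<open>B = X2\<close> it describes the passage from
  \<open>X\<close> to \<open>Xbar\<close>, and with \<open>B\<close> a zero block it shows that
  \<open>C_A\<close> and \<open>S_L\<close> absorb the correction factor.\<close>

lemma append_cols_mult_unit_lower: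
  assumes A: "A \<in> carrier_mat nr a" and B: "B \<in> carrier_mat nr b" and K: "K \<in> carrier_mat b a"
  shows "append_cols A B * unit_lower a b K = append_cols (A + B * K) B"
  unfolding append_cols_def unit_lower_def
  using assms mult_four_block_mat[of A nr a B b "0\<^sub>m 0 a" 0 "0\<^sub>m 0 b" "1\<^sub>m a" a "0\<^sub>m a b" b K "1\<^sub>m b"]
  by simp

section \<open>Gram matrices, orthogonal projections and column spaces\<close>

lemma gram_right_inverse:
  fixes N :: "real mat"
  assumes N: "N \<in> carrier_mat n k"
    and inj: "\<And>v. v \<in> carrier_vec k \<Longrightarrow> N *\<^sub>v v = 0\<^sub>v n \<Longrightarrow> v = 0\<^sub>v k"
  obtains H where "H \<in> carrier_mat k k" "(N\<^sup>T * N) * H = 1\<^sub>m k"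
proof -
  have G: "N\<^sup>T * N \<in> carrier_mat k k" using N by auto
  \<comment> \<open>A kernel vector \<open>v\<close> of the Gram matrix satisfies
    \<open>|N v|^2 = (N\<^sup>T N v) \<bullet> v = 0\<close>, so injectivity of \<open>N\<close>
    forces \<open>v = 0\<close>.\<close>
  have "det (N\<^sup>T * N) \<noteq> 0"
  proof
    assume "det (N\<^sup>T * N) = 0"
    then obtain v where v: "v \<in> carrier_vec k" "v \<noteq> 0\<^sub>v k" "(N\<^sup>T * N) *\<^sub>v v = 0\<^sub>v k"
      using det_0_iff_vec_prod_zero_field[OF G] by auto
    have Nv: "N *\<^sub>v v \<in> carrier_vec n" using N v by auto
    have "(N *\<^sub>v v) \<bullet> (N *\<^sub>v v) = (N\<^sup>T *\<^sub>v (N *\<^sub>v v)) \<bullet> v"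
      using transpose_vec_mult_scalar[OF N v(1) Nv] Nv v N by simp
    also have "N\<^sup>T *\<^sub>v (N *\<^sub>v v) = 0\<^sub>v k"
      using v N by (simp flip: assoc_mult_mat_vec)
    \<comment> \<open>Conjugation is trivial over the reals; the form \<open>\<bullet>c\<close> is
      the one for which definiteness is stated.\<close>
    finally have "(N *\<^sub>v v) \<bullet>c (N *\<^sub>v v) = 0" using v by simp
    then have "N *\<^sub>v v = 0\<^sub>v n" using conjugate_square_eq_0_vec[OF Nv] by simp
    with inj v show False by blast
  qed
  from det_non_zero_imp_unit[OF G this, where b = "()"]
  show ?thesis using that unfolding Units_def ring_mat_def by auto
qed

text \<open>The description by \<open>THE\<close> is unique: for two candidates \<open>y\<close> and
  \<open>z\<close>, the vector \<open>y - z\<close> lies in \<open>W\<close> and is also the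
  difference of two residuals orthogonal to \<open>W\<close>. It is therefore orthogonal to itself
  and vanishes.\<close>

lemma orth_proj_eqI:
  assumes W: "W \<subseteq> carrier_vec n" "\<And>u v. u \<in> W \<Longrightarrow> v \<in> W \<Longrightarrow> u - v \<in> W"
    and x: "x \<in> carrier_vec n" and y: "y \<in> W"
    and orth: "\<And>w. w \<in> W \<Longrightarrow> (x - y) \<bullet> w = 0"
  shows "orth_proj n W x = y"
  unfolding orth_proj_def
proof (rule the_equality)
  show "y \<in> W \<and> x - y \<in> vec_module.orthogonal_complement n W"
    using W x y orth unfolding vec_module.orthogonal_complement_def by auto
next
  fix z assume z: "z \<in> W \<and> x - z \<in> vec_module.orthogonal_complement n W"
  have c: "y \<in> carrier_vec n" "z \<in> carrier_vec n" using W y z by auto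
  have "y - z \<in> W" using W y z by auto
  then have "(x - z) \<bullet> (y - z) = 0" "(x - y) \<bullet> (y - z) = 0"
    using z orth unfolding vec_module.orthogonal_complement_def by auto
  then have "((x - z) - (x - y)) \<bullet> (y - z) = 0"
    using x c by (subst minus_scalar_prod_distrib[of _ n]) auto
  also have "(x - z) - (x - y) = y - z" using x c by (intro eq_vecI) auto
  finally have "(y - z) \<bullet>c (y - z) = 0" by simp
  then have "y - z = 0\<^sub>v n" using conjugate_square_eq_0_vec[of "y - z" n] c by simp
  then have "\<forall>i<n. y $ i - z $ i = 0"
    using c by (metis carrier_vecD index_minus_vec(1) index_zero_vec(1))
  then show "z = y" using c by (intro eq_vecI) auto
qed

lemma mem_col_space_iff:
  fixes M :: "real mat"
  assumes "M \<in> carrier_mat n k"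
  shows "y \<in> vec_space.col_space n M \<longleftrightarrow> (\<exists>v\<in>carrier_vec k. M *\<^sub>v v = y)"
  using vec_space.col_space_eq[OF assms] assms by auto

lemma col_space_minus_closed:
  fixes M :: "real mat"
  assumes M: "M \<in> carrier_mat n k"
    and "u \<in> vec_space.col_space n M" "v \<in> vec_space.col_space n M"
  shows "u - v \<in> vec_space.col_space n M"
proof -
  obtain a b where "a \<in> carrier_vec k" "M *\<^sub>v a = u" "b \<in> carrier_vec k" "M *\<^sub>v b = v"
    using assms(2,3) mem_col_space_iff[OF M] by auto
  then have "M *\<^sub>v (a - b) = u - v" "a - b \<in> carrier_vec k"
    using mult_minus_distrib_mat_vec[OF M, of a b] by auto
  then show ?thesis using mem_col_space_iff[OF M] by blast
qed

section \<open>Gram matrices and factorizations in a GSVD\<close>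

lemma orthonormal_mat_gram:
  assumes P: "orthonormal_mat k P" and C: "C \<in> carrier_mat k n" and V: "V \<in> carrier_mat n n"
  shows "(P * C * V)\<^sup>T * (P * C * V) = V\<^sup>T * (C\<^sup>T * C) * V"
proof -
  have Pc: "P \<in> carrier_mat k k" and PP: "P\<^sup>T * P = 1\<^sub>m k"
    using P unfolding orthonormal_mat_def by auto
  have CV: "C * V \<in> carrier_mat k n" using C V by auto
  have "P * C * V = P * (C * V)" using Pc C V by (simp add: assoc_mult_mat[of _ k k _ n _ n])
  then have "(P * C * V)\<^sup>T * (P * C * V) = (C * V)\<^sup>T * P\<^sup>T * (P * (C * V))"
    using transpose_mult[OF Pc CV] by simp
  also have "\<dots> = (C * V)\<^sup>T * (P\<^sup>T * (P * (C * V)))"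
    using Pc CV by (intro assoc_mult_mat[of _ n k _ k _ n]) auto
  also have "P\<^sup>T * (P * (C * V)) = P\<^sup>T * P * (C * V)"
    using Pc CV by (intro assoc_mult_mat[symmetric, of _ k k _ k _ n]) auto
  \<comment> \<open>Here the orthogonal factor cancels; the surrounding steps only transpose and
    reassociate.\<close>
  also have "(C * V)\<^sup>T * (P\<^sup>T * P * (C * V)) = V\<^sup>T * C\<^sup>T * (C * V)"
    unfolding PP transpose_mult[OF C V] left_mult_one_mat[OF CV] ..
  also have "\<dots> = V\<^sup>T * (C\<^sup>T * (C * V))"
    using C V by (intro assoc_mult_mat[of _ n n _ k _ n]) auto
  also have "C\<^sup>T * (C * V) = C\<^sup>T * C * V"
    using C V by (intro assoc_mult_mat[symmetric, of _ n k _ n _ n]) auto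
  also have "V\<^sup>T * (C\<^sup>T * C * V) = V\<^sup>T * (C\<^sup>T * C) * V"
    using C V by (intro assoc_mult_mat[symmetric, of _ n n _ n _ n]) auto
  finally show ?thesis .
qed

lemma gsvd_factorsE:
  assumes "gsvd_factors m p n r C S"
  obtains \<Sigma>A \<Sigma>L where "\<Sigma>A \<in> carrier_mat m r" "\<Sigma>L \<in> carrier_mat p r"
    "\<Sigma>A\<^sup>T * \<Sigma>A + \<Sigma>L\<^sup>T * \<Sigma>L = 1\<^sub>m r"
    "C = append_cols \<Sigma>A (0\<^sub>m m (n - r))" "S = append_cols \<Sigma>L (0\<^sub>m p (n - r))"
proof -
  from assms obtain q1 q2 q3 c s where q: "q1 + q2 + q3 = r" "q1 + q2 \<le> m" "r \<le> p + q1"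
    and f: "(gsvd_Sigma_A m q1 q2 q3 c)\<^sup>T * gsvd_Sigma_A m q1 q2 q3 c
        + (gsvd_Sigma_L p r q1 q2 q3 s)\<^sup>T * gsvd_Sigma_L p r q1 q2 q3 s = 1\<^sub>m r"
      "C = append_cols (gsvd_Sigma_A m q1 q2 q3 c) (0\<^sub>m m (n - r))"
      "S = append_cols (gsvd_Sigma_L p r q1 q2 q3 s) (0\<^sub>m p (n - r))"
    unfolding gsvd_factors_def Let_def by (elim exE conjE) (rule that; assumption)
  \<comment> \<open>The bounds in \<open>q\<close> keep the natural subtractions
    \<open>m - q1 - q2\<close> and \<open>p + q1 - r\<close> from truncating, so the block heights
    add up to \<open>m\<close> and \<open>p\<close>.\<close>
  have "gsvd_Sigma_A m q1 q2 q3 c \<in> carrier_mat m r"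
    "gsvd_Sigma_L p r q1 q2 q3 s \<in> carrier_mat p r"
    using q by (intro carrier_matI;
        simp add: gsvd_Sigma_A_def gsvd_Sigma_L_def dim_diag_block_mat mat_diag_def)+
  with f that show ?thesis by blast
qed

text \<open>In short, \<open>X^(-1) = T (X T)^(-1)\<close>, and the factor \<open>T\<close> is
  absorbed by \<open>C\<close>.\<close>

lemma factorization_change_right:
  fixes X :: "real mat"
  assumes P: "P \<in> carrier_mat k k" and C: "C \<in> carrier_mat k n"
    and X: "X \<in> carrier_mat n n" "invertible_mat X"
    and T: "T \<in> carrier_mat n n" and inv: "invertible_mat (X * T)"
    and CT: "C * T = C"
  shows "P * C * mat_inv X = P * C * mat_inv (X * T)"
proof -
  note V = mat_inv_inverse[OF X]
  have XT: "X * T \<in> carrier_mat n n" using X T by auto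
  note W = mat_inv_inverse[OF XT inv]
  have PC: "P * C \<in> carrier_mat k n" using P C by auto
  have VX: "mat_inv X * (X * T) = T"
    using V X T by (simp flip: assoc_mult_mat[of _ n n _ n _ n])
  have PCT: "P * C * T = P * C"
    using P C T CT by (simp add: assoc_mult_mat[of _ k k _ n _ n])
  have "P * C * mat_inv X = P * C * mat_inv X * (X * T * mat_inv (X * T))"
    using W V PC by simp
  also have "\<dots> = P * C * mat_inv X * (X * T) * mat_inv (X * T)"
    using W V PC XT by (intro assoc_mult_mat[symmetric, of _ k n _ n _ n]) auto
  also have "P * C * mat_inv X * (X * T) = P * C * (mat_inv X * (X * T))"
    using V PC XT by (intro assoc_mult_mat[of _ k n _ n _ n]) auto
  finally show ?thesis using VX PCT by simp
qed

text \<open>The orthogonal factors cancel in each Gram matrix, both summands share the outer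
  factors, and the normalisation of the diagonal factors turns the upper left block of the sum into
  the identity.\<close>

lemma gsvd_gram:
  assumes A: "A \<in> carrier_mat m n" and L: "L \<in> carrier_mat p n" and r: "r \<le> n"
    and gsvd: "is_gsvd m p n r A L P_A C_A P_L S_L X"
  shows "A\<^sup>T * A + L\<^sup>T * L = (mat_inv X)\<^sup>T
    * four_block_mat (1\<^sub>m r) (0\<^sub>m r (n - r)) (0\<^sub>m (n - r) r) (0\<^sub>m (n - r) (n - r)) * mat_inv X"
proof -
  let ?V = "mat_inv X"
  have P: "orthonormal_mat m P_A" "orthonormal_mat p P_L"
    and X: "X \<in> carrier_mat n n" "invertible_mat X" and "gsvd_factors m p n r C_A S_L"
    and AL: "A = P_A * C_A * ?V" "L = P_L * S_L * ?V"
    using gsvd unfolding is_gsvd_def by auto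
  from this(5) obtain \<Sigma>A \<Sigma>L where S: "\<Sigma>A \<in> carrier_mat m r" "\<Sigma>L \<in> carrier_mat p r"
    and one: "\<Sigma>A\<^sup>T * \<Sigma>A + \<Sigma>L\<^sup>T * \<Sigma>L = 1\<^sub>m r"
    and CS: "C_A = append_cols \<Sigma>A (0\<^sub>m m (n - r))" "S_L = append_cols \<Sigma>L (0\<^sub>m p (n - r))"
    by (rule gsvd_factorsE)
  have V: "?V \<in> carrier_mat n n" by (rule mat_inv_inverse(3)[OF X])
  have C: "C_A \<in> carrier_mat m n" "S_L \<in> carrier_mat p n"
    using append_cols_carrier[OF S(1), of "0\<^sub>m m (n - r)" "n - r"]
      append_cols_carrier[OF S(2), of "0\<^sub>m p (n - r)" "n - r"] CS r by auto
  have CC: "C_A\<^sup>T * C_A \<in> carrier_mat n n" "S_L\<^sup>T * S_L \<in> carrier_mat n n"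
    using C by auto
  have "A\<^sup>T * A + L\<^sup>T * L = ?V\<^sup>T * (C_A\<^sup>T * C_A) * ?V + ?V\<^sup>T * (S_L\<^sup>T * S_L) * ?V"
    unfolding AL orthonormal_mat_gram[OF P(1) C(1) V] orthonormal_mat_gram[OF P(2) C(2) V] ..
  also have "\<dots> = (?V\<^sup>T * (C_A\<^sup>T * C_A) + ?V\<^sup>T * (S_L\<^sup>T * S_L)) * ?V"
    using V CC by (intro add_mult_distrib_mat[symmetric, of _ n n _ _ n]) auto
  also have "?V\<^sup>T * (C_A\<^sup>T * C_A) + ?V\<^sup>T * (S_L\<^sup>T * S_L) = ?V\<^sup>T * (C_A\<^sup>T * C_A + S_L\<^sup>T * S_L)"
    using V CC by (intro mult_add_distrib_mat[symmetric, of _ n n _ n]) auto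
  also have "C_A\<^sup>T * C_A + S_L\<^sup>T * S_L
      = four_block_mat (1\<^sub>m r) (0\<^sub>m r (n - r)) (0\<^sub>m (n - r) r) (0\<^sub>m (n - r) (n - r))"
    unfolding CS gram_append_zero_cols[OF S(1)] gram_append_zero_cols[OF S(2)]
    using S one by (subst add_four_block_mat[of _ r r _ "n - r" _ "n - r"]) auto
  finally show ?thesis .
qed

section \<open>Null space of \<open>M\<close> and the projected factor \<open>Xbar\<close>\<close>

theorem proposition2p1:
  fixes m n p r :: nat
    and A L P_A C_A P_L S_L X M X1 X2 Xbar1 Xbar :: "real mat"
  assumes "A \<in> carrier_mat m n" and "L \<in> carrier_mat p n"
    and "vec_space.rank (m + p) (A @\<^sub>r L) = r"
    and "is_gsvd m p n r A L P_A C_A P_L S_L X"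
    and "M = A\<^sup>T * A + L\<^sup>T * L"
    and "X1 = mat_of_cols n (take r (cols X))"
    and "X2 = mat_of_cols n (drop r (cols X))"
    and "Xbar1 = mat_of_cols n (map (orth_proj n (vec_space.col_space n M)) (cols X1))"
    and "Xbar = append_cols Xbar1 X2"
  shows "vec_space.col_space n X2 = mat_kernel M
    \<and> invertible_mat Xbar
    \<and> A = P_A * C_A * mat_inv Xbar
    \<and> L = P_L * S_L * mat_inv Xbar"
proof -
  define V where "V = mat_inv X"
  define D :: "real mat"
    where "D = four_block_mat (1\<^sub>m r) (0\<^sub>m r (n - r)) (0\<^sub>m (n - r) r) (0\<^sub>m (n - r) (n - r))"
  have "A @\<^sub>r L \<in> carrier_mat (m + p) n"
    using assms(1,2) by (rule carrier_append_rows)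
  \<comment> \<open>A rank is at most the number of columns; hence \<open>r + (n - r) = n\<close>
    despite truncated subtraction.\<close>
  then have r: "r \<le> n" using vec_space.rank_le_nc assms(3) by blast
  have P: "orthonormal_mat m P_A" "orthonormal_mat p P_L"
    and X: "X \<in> carrier_mat n n" "invertible_mat X" and fac: "gsvd_factors m p n r C_A S_L"
    and AL: "A = P_A * C_A * mat_inv X" "L = P_L * S_L * mat_inv X"
    using assms(4) unfolding is_gsvd_def by auto
  have V: "X * V = 1\<^sub>m n" "V * X = 1\<^sub>m n" "V \<in> carrier_mat n n"
    using mat_inv_inverse[OF X] unfolding V_def by auto
  have D: "D \<in> carrier_mat n n" using r unfolding D_def by auto
  have M: "M = V\<^sup>T * D * V"
    unfolding assms(5) V_def D_def by (rule gsvd_gram[OF assms(1,2) r assms(4)])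
  have Mc: "M \<in> carrier_mat n n" using M V D by auto
  have sym: "M\<^sup>T = M"
    using assms(1,2) unfolding assms(5) by (simp add: transpose_add[of _ n n] transpose_mult[of _ n _ _ n])
  have X1: "X1 \<in> carrier_mat n r" and X2: "X2 \<in> carrier_mat n (n - r)"
    using X r unfolding assms(6,7) by auto
  have X12: "append_cols X1 X2 = X"
    unfolding assms(6,7) by (rule append_cols_cols[OF X(1) r])
  have M_mult: "M *\<^sub>v x = V\<^sup>T *\<^sub>v (D *\<^sub>v (V *\<^sub>v x))" if "x \<in> carrier_vec n" for x
    using that V D unfolding M by (simp add: assoc_mult_mat_vec[of _ n n _ n])
  have VX: "V *\<^sub>v (X *\<^sub>v x) = x" if "x \<in> carrier_vec n" for x
    using that V X by (simp flip: assoc_mult_mat_vec)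
  have XV: "X *\<^sub>v (V *\<^sub>v x) = x" if "x \<in> carrier_vec n" for x
    using that V X by (simp flip: assoc_mult_mat_vec)
  have "V\<^sup>T * X\<^sup>T = 1\<^sub>m n" "X\<^sup>T * V\<^sup>T = 1\<^sub>m n"
    unfolding transpose_mult[OF X(1) V(3), symmetric] transpose_mult[OF V(3) X(1), symmetric] V
    by simp_all
  then have VXT: "V\<^sup>T *\<^sub>v (X\<^sup>T *\<^sub>v x) = x" and XVT: "X\<^sup>T *\<^sub>v (V\<^sup>T *\<^sub>v x) = x" if "x \<in> carrier_vec n" for x
    using that V X by (simp_all flip: assoc_mult_mat_vec[of _ n n _ n])
  have D_mult: "D *\<^sub>v (a @\<^sub>v b) = a @\<^sub>v 0\<^sub>v (n - r)"
    if "a \<in> carrier_vec r" "b \<in> carrier_vec (n - r)" for a b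
    unfolding D_def using that
    by (subst mult_mat_vec_split[of _ r _ "n - r"]) auto
  have X2_mult: "X *\<^sub>v (0\<^sub>v r @\<^sub>v b) = X2 *\<^sub>v b" if "b \<in> carrier_vec (n - r)" for b
    using append_cols_mult_vec[OF X1 X2 zero_carrier_vec that] mult_mat_zero_vec[OF X1] X2 that
    unfolding X12 by simp
  have cat: "a @\<^sub>v b \<in> carrier_vec n" if "a \<in> carrier_vec r" "b \<in> carrier_vec (n - r)" for a b :: "real vec"
    using append_carrier_vec[OF that] r by simp
  \<comment> \<open>\<open>V\<close> sends \<open>X2 b\<close> back to its coordinates
    \<open>0 @ b\<close> with respect to \<open>X\<close>, and \<open>D\<close> annihilates
    these.\<close>
  have MX2: "M *\<^sub>v (X2 *\<^sub>v b) = 0\<^sub>v n" if b: "b \<in> carrier_vec (n - r)" for b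
  proof -
    have "0\<^sub>v r @\<^sub>v 0\<^sub>v (n - r) = (0\<^sub>v n :: real vec)" using r by (intro eq_vecI) auto
    then show ?thesis
      using b cat[of "0\<^sub>v r" b] X V D_mult[of "0\<^sub>v r" b] unfolding X2_mult[OF b, symmetric]
      by (simp add: M_mult VX mult_mat_zero_vec[of _ n n])
  qed
  have ker: "vec_space.col_space n X2 = mat_kernel M"
  proof (intro Set.set_eqI iffI)
    fix y assume "y \<in> vec_space.col_space n X2"
    then obtain b where "b \<in> carrier_vec (n - r)" "y = X2 *\<^sub>v b"
      using mem_col_space_iff[OF X2] by auto
    then show "y \<in> mat_kernel M" using MX2 X2 by (intro mat_kernelI[OF Mc]) auto
  next
    fix y assume "y \<in> mat_kernel M"
    then have y: "y \<in> carrier_vec n" "M *\<^sub>v y = 0\<^sub>v n" using mat_kernelD[OF Mc] by auto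
    \<comment> \<open>Coordinates of \<open>y\<close> with respect to the columns of
      \<open>X\<close>. As \<open>V\<^sup>T\<close> is invertible, \<open>M y = 0\<close> forces
      \<open>D (V y) = 0\<close>, that is \<open>a = 0\<close>.\<close>
    define a b where "a = vec_first (V *\<^sub>v y) r" and "b = vec_last (V *\<^sub>v y) (n - r)"
    have ab: "a \<in> carrier_vec r" "b \<in> carrier_vec (n - r)" unfolding a_def b_def by auto
    have Vy: "V *\<^sub>v y = a @\<^sub>v b"
      unfolding a_def b_def using V y r by (intro vec_first_last_append[symmetric]) auto
    have "a @\<^sub>v 0\<^sub>v (n - r) = X\<^sup>T *\<^sub>v (M *\<^sub>v y)"
      unfolding M_mult[OF y(1)] Vy D_mult[OF ab]
      by (rule XVT[symmetric]) (use ab cat in auto)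
    also have "\<dots> = 0\<^sub>v r @\<^sub>v 0\<^sub>v (n - r)" using y X r by (intro eq_vecI) auto
    finally have "a = 0\<^sub>v r" using ab append_vec_eq[of a r "0\<^sub>v r"] by auto
    then have "X2 *\<^sub>v b = y" using X2_mult[OF ab(2)] XV[OF y(1)] Vy by simp
    then show "y \<in> vec_space.col_space n X2" using mem_col_space_iff[OF X2] ab by auto
  qed
  \<comment> \<open>The columns of \<open>X2\<close> are independent as columns of an invertible
    matrix; this makes their Gram matrix invertible.\<close>
  have inj: "b = 0\<^sub>v (n - r)" if b: "b \<in> carrier_vec (n - r)" and "X2 *\<^sub>v b = 0\<^sub>v n" for b
  proof -
    have "0\<^sub>v r @\<^sub>v b = V *\<^sub>v (X2 *\<^sub>v b)"
      using VX[OF cat[OF zero_carrier_vec b]] X2_mult[OF b] by simp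
    also have "\<dots> = 0\<^sub>v r @\<^sub>v 0\<^sub>v (n - r)" using that V r by (intro eq_vecI) auto
    finally show ?thesis using append_vec_eq[of "0\<^sub>v r" r "0\<^sub>v r"] by auto
  qed
  \<comment> \<open>The orthogonal complement of the null space lies in the range; an explicit
    preimage replaces a dimension count.\<close>
  have range: "y \<in> vec_space.col_space n M"
    if y: "y \<in> carrier_vec n" and "X2\<^sup>T *\<^sub>v y = 0\<^sub>v (n - r)" for y
  proof -
    have "X\<^sup>T *\<^sub>v y = (X1\<^sup>T *\<^sub>v y) @\<^sub>v 0\<^sub>v (n - r)"
      using transpose_append_cols_mult_vec[OF X1 X2 y] that unfolding X12 by simp
    then have "D *\<^sub>v (X\<^sup>T *\<^sub>v y) = X\<^sup>T *\<^sub>v y"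
      using D_mult[of "X1\<^sup>T *\<^sub>v y" "0\<^sub>v (n - r)"] X1 y by simp
    then have "M *\<^sub>v (X *\<^sub>v (X\<^sup>T *\<^sub>v y)) = y"
      using X y by (simp add: M_mult VX VXT)
    moreover have "X *\<^sub>v (X\<^sup>T *\<^sub>v y) \<in> carrier_vec n" using X y by auto
    ultimately show ?thesis using mem_col_space_iff[OF Mc] by blast
  qed
  obtain H where H: "H \<in> carrier_mat (n - r) (n - r)" "(X2\<^sup>T * X2) * H = 1\<^sub>m (n - r)"
    using gram_right_inverse[OF X2 inj] by blast
  \<comment> \<open>Solution of the normal equations
    \<open>X2\<^sup>T X2 K = - X2\<^sup>T X1\<close>, chosen so that the columns of
    \<open>X1 + X2 K\<close> are orthogonal to those of \<open>X2\<close>.\<close>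
  define K where "K = - (H * (X2\<^sup>T * X1))"
  have K: "K \<in> carrier_mat (n - r) r" using H X1 X2 unfolding K_def by auto
  define Y where "Y = X1 + X2 * K"
  have Y: "Y \<in> carrier_mat n r" using X1 X2 K unfolding Y_def by auto
  have N: "X2\<^sup>T * X1 \<in> carrier_mat (n - r) r" using X1 X2 by auto
  have "X2\<^sup>T * X2 * K = - (X2\<^sup>T * X2 * (H * (X2\<^sup>T * X1)))"
    unfolding K_def using H X2 N by (intro uminus_mult_right_mat) auto
  also have "X2\<^sup>T * X2 * (H * (X2\<^sup>T * X1)) = X2\<^sup>T * X2 * H * (X2\<^sup>T * X1)"
    using H X2 N by (intro assoc_mult_mat[symmetric, of _ "n - r" "n - r" _ "n - r" _ r]) auto
  finally have "X2\<^sup>T * X2 * K = - (X2\<^sup>T * X1)"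
    unfolding H(2) left_mult_one_mat[OF N] .
  then have "X2\<^sup>T * Y = X2\<^sup>T * X1 + - (X2\<^sup>T * X1)"
    unfolding Y_def using X1 X2 K
    by (simp add: mult_add_distrib_mat[of _ "n - r" n _ r] assoc_mult_mat[of _ "n - r" n _ "n - r" _ r])
  then have X2Y: "X2\<^sup>T * Y = 0\<^sub>m (n - r) r" using uminus_r_inv_mat[OF N] by (rule trans)
  have proj: "orth_proj n (vec_space.col_space n M) (col X1 j) = col Y j" if j: "j < r" for j
  proof (rule orth_proj_eqI)
    show "vec_space.col_space n M \<subseteq> carrier_vec n"
      using mem_col_space_iff[OF Mc] Mc by auto
    show "u - v \<in> vec_space.col_space n M"
      if "u \<in> vec_space.col_space n M" "v \<in> vec_space.col_space n M" for u v
      using col_space_minus_closed[OF Mc that] .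
    show "col X1 j \<in> carrier_vec n" using X1 by auto
    have "X2\<^sup>T *\<^sub>v col Y j = col (X2\<^sup>T * Y) j" using X2 Y j by (intro eq_vecI) auto
    also have "\<dots> = 0\<^sub>v (n - r)" using X2Y j by auto
    finally show "col Y j \<in> vec_space.col_space n M" using range Y by auto
    \<comment> \<open>The residual is a combination of columns of \<open>X2\<close> and so lies in
      the null space of \<open>M\<close>.\<close>
    have "col X1 j - col Y j = X2 *\<^sub>v (- col K j)"
      using X1 X2 K j unfolding Y_def by (intro eq_vecI) auto
    moreover have "M *\<^sub>v (X2 *\<^sub>v (- col K j)) = 0\<^sub>v n" using K by (intro MX2) (simp add: carrier_vecI)
    ultimately have z: "M *\<^sub>v (col X1 j - col Y j) = 0\<^sub>v n" by simp
    fix w assume "w \<in> vec_space.col_space n M"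
    then obtain v where v: "v \<in> carrier_vec n" "w = M *\<^sub>v v"
      using mem_col_space_iff[OF Mc] by auto
    have d: "col X1 j - col Y j \<in> carrier_vec n" using Y by (simp add: carrier_vecI)
    \<comment> \<open>Symmetry moves \<open>M\<close> from \<open>v\<close> to the residual, which
      it annihilates.\<close>
    show "(col X1 j - col Y j) \<bullet> w = 0"
      using transpose_vec_mult_scalar[OF Mc v(1) d] v z sym by simp
  qed
  have "Xbar1 = Y"
    unfolding assms(8) using X1 Y by (intro eq_matI) (auto simp: mat_of_cols_index proj)
  then have Xbar: "Xbar = X * unit_lower r (n - r) K"
    unfolding assms(9) Y_def using append_cols_mult_unit_lower[OF X1 X2 K] X12 by simp
  have U: "unit_lower r (n - r) J \<in> carrier_mat n n" for J
    using unit_lower_carrier[of r "n - r" J] r by simp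
  have U0: "unit_lower r (n - r) (0\<^sub>m (n - r) r) = 1\<^sub>m n"
    using r unfolding unit_lower_def by simp
  have UU: "unit_lower r (n - r) K * unit_lower r (n - r) (- K) = 1\<^sub>m n"
    using unit_lower_mult[OF K, of "- K"] K U0 by (simp add: uminus_r_inv_mat)
  have right: "X * unit_lower r (n - r) K * (unit_lower r (n - r) (- K) * V) = 1\<^sub>m n"
  proof -
    have "X * unit_lower r (n - r) K * (unit_lower r (n - r) (- K) * V)
        = X * (unit_lower r (n - r) K * (unit_lower r (n - r) (- K) * V))"
      using U[of K] U[of "- K"] X V by (intro assoc_mult_mat[of _ n n _ n _ n]) auto
    also have "unit_lower r (n - r) K * (unit_lower r (n - r) (- K) * V)
        = unit_lower r (n - r) K * unit_lower r (n - r) (- K) * V"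
      using U[of K] U[of "- K"] V by (intro assoc_mult_mat[symmetric, of _ n n _ n _ n]) auto
    finally show ?thesis using UU V by simp
  qed
  have XU: "X * unit_lower r (n - r) K \<in> carrier_mat n n"
    and UV: "unit_lower r (n - r) (- K) * V \<in> carrier_mat n n"
    using mult_carrier_mat[OF X(1) U] mult_carrier_mat[OF U V(3)] .
  \<comment> \<open>For square matrices the right inverse just found is also a left inverse.\<close>
  have inv: "invertible_mat (X * unit_lower r (n - r) K)"
    using invertible_matI[OF XU UV right mat_mult_left_right_inverse[OF XU UV right]] .
  from fac obtain \<Sigma>A \<Sigma>L where S: "\<Sigma>A \<in> carrier_mat m r" "\<Sigma>L \<in> carrier_mat p r"
    and CS: "C_A = append_cols \<Sigma>A (0\<^sub>m m (n - r))" "S_L = append_cols \<Sigma>L (0\<^sub>m p (n - r))"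
    by (rule gsvd_factorsE)
  have C: "C_A \<in> carrier_mat m n" "S_L \<in> carrier_mat p n"
    using append_cols_carrier[OF S(1), of "0\<^sub>m m (n - r)" "n - r"]
      append_cols_carrier[OF S(2), of "0\<^sub>m p (n - r)" "n - r"] CS r by auto
  \<comment> \<open>The column operation draws on the last \<open>n - r\<close> columns, which are
    zero here.\<close>
  have CU: "C_A * unit_lower r (n - r) K = C_A" "S_L * unit_lower r (n - r) K = S_L"
    unfolding CS using S K by (auto simp: append_cols_mult_unit_lower)
  have "A = P_A * C_A * mat_inv Xbar" "L = P_L * S_L * mat_inv Xbar"
    unfolding Xbar AL using P
    by (auto intro!: factorization_change_right[OF _ C(1) X U inv CU(1)]
        factorization_change_right[OF _ C(2) X U inv CU(2)] simp: orthonormal_mat_def)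
  with ker inv show ?thesis unfolding Xbar by blast
qed

end
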